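(* Let $F$ be a field and let $(q,e)=(5,33)$. Then $m=m(q,e)=3$, and for every $n\in\mathbb{N}$ with $e\mid q^n-1$, $$\mathrm{LL}(A(q,n,e))=\left\lfloor\frac{(q-1)n}{m}\right\rfloor+\epsilon,$$ where $\epsilon=0$ if $n\equiv 10\pmod{30}$, and $\epsilon=1$ otherwise.
   Context: $\mathbb{N}$ denotes the set of positive integers, $\mathbb{N}_0=\mathbb{N}\cup\{0\}$. For $q,e\in\mathbb{N}$ with $\gcd(q,e)=1$, $m(q,e)$ is the smallest positive integer $t$ such that there exist $i_1,\dots,i_t\in\mathbb{N}_0$ (repetitions allowed) with $e\mid q^{i_1}+\dots+q^{i_t}$. For a field $F$ and $q,n,e\in\mathbb{N}$ with $q>1$ and $e\mid q^n-1$, let $I=(X_1^q,\dots,X_n^q)$ in the polynomial algebra $F[X_1,\dots,X_n]$ and $x_j=X_j+I$. Then $A(q,n,e)$ is the unital $F$-subalgebra of $F[x_1,\dots,x_n]=F[X_1,\dots,X_n]/I$ generated by all monomials $x_1^{i_1}\cdots x_n^{i_n}$ with $i_1+qi_2+\dots+q^{n-1}i_n\equiv 0\pmod e$. For a finite-dimensional algebra $A$ with Jacobson radical $\mathrm{J}(A)$, the Loewy length $\mathrm{LL}(A)$ is the smallest $l\in\mathbb{N}_0$ with $\mathrm{J}(A)^l=0$. *)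

theory Defs
  imports
    "HOL-Algebra.Generated_Rings"
    "HOL-Algebra.Ideal_Product"
    "HOL-Algebra.QuotRing"
    "HOL-Library.Poly_Mapping"
    "HOL-Number_Theory.Cong"
begin

definition m_number :: "nat \<Rightarrow> nat \<Rightarrow> nat" where
  "m_number q e = (LEAST t. t > 0 \<and> (\<exists>i :: nat \<Rightarrow> nat. e dvd (\<Sum>k=1..t. q ^ i k)))"

section \<open>The algebras \<open>A(q,n,e)\<close>\<close>

text \<open>
  The monomial with exponent vector \<open>m :: nat \<Rightarrow>\<^sub>0 nat\<close> stands for \<open>\<Prod>j. X\<^sub>j ^ lookup m j\<close>, and a
  polynomial maps monomials to coefficients. The ring \<open>F[X\<^sub>1,\<dots>,X\<^sub>n]\<close> consists of the
  polynomials in whose monomials only indices from \<open>{1..n}\<close> occur; the field \<open>F\<close> is the type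
  \<open>'f\<close>, passed as a type argument.
\<close>

definition mpoly_ring :: "'f::field itself \<Rightarrow> nat \<Rightarrow> ((nat \<Rightarrow>\<^sub>0 nat) \<Rightarrow>\<^sub>0 'f) ring" where
  "mpoly_ring F n =
     \<lparr> carrier = {p. \<forall>m \<in> Poly_Mapping.keys p. Poly_Mapping.keys m \<subseteq> {1..n}},
       monoid.mult = (*), one = 1, zero = 0, add = (+) \<rparr>"

definition mvar :: "nat \<Rightarrow> (nat \<Rightarrow>\<^sub>0 nat) \<Rightarrow>\<^sub>0 'f::field" where
  "mvar j = Poly_Mapping.single (Poly_Mapping.single j 1) 1"

definition mconst :: "'f \<Rightarrow> (nat \<Rightarrow>\<^sub>0 nat) \<Rightarrow>\<^sub>0 'f::field" where
  "mconst c = Poly_Mapping.single 0 c"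

definition power_ideal :: "'f::field itself \<Rightarrow> nat \<Rightarrow> nat \<Rightarrow> ((nat \<Rightarrow>\<^sub>0 nat) \<Rightarrow>\<^sub>0 'f) set" where
  "power_ideal F q n = Idl\<^bsub>mpoly_ring F n\<^esub> ((\<lambda>j. mvar j ^ q) ` {1..n})"

definition trunc_ring :: "'f::field itself \<Rightarrow> nat \<Rightarrow> nat \<Rightarrow> ((nat \<Rightarrow>\<^sub>0 nat) \<Rightarrow>\<^sub>0 'f) set ring" where
  "trunc_ring F q n = mpoly_ring F n Quot power_ideal F q n"

definition trunc_class ::
  "'f::field itself \<Rightarrow> nat \<Rightarrow> nat \<Rightarrow> ((nat \<Rightarrow>\<^sub>0 nat) \<Rightarrow>\<^sub>0 'f) \<Rightarrow> ((nat \<Rightarrow>\<^sub>0 nat) \<Rightarrow>\<^sub>0 'f) set" where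
  "trunc_class F q n p = power_ideal F q n +>\<^bsub>mpoly_ring F n\<^esub> p"

definition trunc_monomial ::
  "'f::field itself \<Rightarrow> nat \<Rightarrow> nat \<Rightarrow> (nat \<Rightarrow> nat) \<Rightarrow> ((nat \<Rightarrow>\<^sub>0 nat) \<Rightarrow>\<^sub>0 'f) set" where
  "trunc_monomial F q n i =
     (\<Otimes>\<^bsub>trunc_ring F q n\<^esub>j\<in>{1..n}. trunc_class F q n (mvar j) [^]\<^bsub>trunc_ring F q n\<^esub> i j)"

text \<open>
  The unital \<open>F\<close>-subalgebra generated by a set is the subring generated by that set together with
  the image of \<open>F\<close>.
\<close>

definition A_alg ::
  "'f::field itself \<Rightarrow> nat \<Rightarrow> nat \<Rightarrow> nat \<Rightarrow> ((nat \<Rightarrow>\<^sub>0 nat) \<Rightarrow>\<^sub>0 'f) set ring" where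
  "A_alg F q n e = (trunc_ring F q n) \<lparr> carrier :=
     generate_ring (trunc_ring F q n)
       (range (\<lambda>c. trunc_class F q n (mconst c)) \<union>
        {trunc_monomial F q n i | i. [(\<Sum>j=1..n. q ^ (j - 1) * i j) = 0] (mod e)}) \<rparr>"

section \<open>Loewy length\<close>

text \<open>
  Only used for commutative rings, where maximal left ideals are the same as maximal ideals. The
  intersection with the carrier only matters for the zero ring, which has no maximal ideal.
\<close>

definition jacobson_radical :: "('a, 'b) ring_scheme \<Rightarrow> 'a set" where
  "jacobson_radical R = carrier R \<inter> \<Inter>{M. maximalideal M R}"

text \<open>
  In the monoid of ideals of \<open>R\<close>, the \<open>l\<close>-th power of \<open>J\<close> is the ideal generated by all
  \<open>l\<close>-fold products of elements of \<open>J\<close>, and the \<open>0\<close>-th power is \<open>R\<close> itself.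
\<close>

definition loewy_length :: "('a, 'b) ring_scheme \<Rightarrow> nat" where
  "loewy_length R = (LEAST l :: nat. jacobson_radical R [^]\<^bsub>ideals_set R\<^esub> l = {\<zero>\<^bsub>R\<^esub>})"

end

theory Submission
  imports Defs
begin

text \<open>
  The algebra \<open>A\<close> is spanned by the classes of monomials whose exponent vector has weight
  \<open>i\<^sub>1 + q i\<^sub>2 + \<dots>\<close> divisible by \<open>e\<close>, and its radical \<open>J\<close> by those with a nonzero exponent vector.
  Hence \<open>J\<^sup>l\<close> is spanned by the monomials whose exponent vector is a sum of at least \<open>l\<close> nonzero
  vectors of weight zero modulo \<open>e\<close>, and the Loewy length is one more than the largest number of
  such vectors whose sum has all entries below \<open>q\<close>.

  For \<open>(q, e) = (5, 33)\<close> every such vector has degree at least 3, which gives the upper bound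
  \<open>\<lfloor>4 n / 3\<rfloor>\<close> for this number. The vectors of degree 3 are supported on positions of one parity. If
  \<open>n = 30 k + 10\<close> and the bound is attained, then all of the capacity is used: each parity class
  carries \<open>20 k + 6\<close> vectors of degree 3, and the remaining vector has degree 2 on each class. As the
  powers of 5 on a full class sum to 0 modulo 11, so do the two that remain, but -1 is not a power
  of 5 modulo 11. Otherwise the bound is attained, by periodicity, from small explicit packings.
\<close>

section \<open>Polynomials with prescribed support\<close>

text \<open>The polynomial ring and the power ideal have this form, and the algebra and the powers
  of its radical are images of such sets, so that inclusions between them become questions about
  exponent vectors.\<close>

definition poly_on :: "(nat \<Rightarrow>\<^sub>0 nat) set \<Rightarrow> ((nat \<Rightarrow>\<^sub>0 nat) \<Rightarrow>\<^sub>0 'f::field) set" where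
  "poly_on K = {p. Poly_Mapping.keys p \<subseteq> K}"

lemma poly_on_zero: "0 \<in> poly_on K"
  by (simp add: poly_on_def)

lemma poly_on_add: "p \<in> poly_on K \<Longrightarrow> p' \<in> poly_on K \<Longrightarrow> p + p' \<in> poly_on K"
  using Poly_Mapping.keys_add[of p p'] by (auto simp: poly_on_def)

lemma poly_on_uminus: "p \<in> poly_on K \<Longrightarrow> - p \<in> poly_on K"
  by (auto simp: poly_on_def in_keys_iff)

lemma poly_on_diff: "p \<in> poly_on K \<Longrightarrow> p' \<in> poly_on K \<Longrightarrow> p - p' \<in> poly_on K"
  using poly_on_add[OF _ poly_on_uminus] by fastforce

lemma poly_on_mult:
  assumes "p \<in> poly_on K" "p' \<in> poly_on K'" "\<And>a b. a \<in> K \<Longrightarrow> b \<in> K' \<Longrightarrow> a + b \<in> L"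
  shows "p * p' \<in> poly_on L"
  using assms Poly_Mapping.keys_mult[of p p'] unfolding poly_on_def by blast

lemma poly_on_single: "m \<in> K \<Longrightarrow> Poly_Mapping.single m c \<in> poly_on K"
  by (simp add: poly_on_def)

lemma poly_on_mono: "K \<subseteq> L \<Longrightarrow> p \<in> poly_on K \<Longrightarrow> p \<in> poly_on L"
  by (auto simp: poly_on_def)

lemma sum_single_lookup:
  "(\<Sum>m\<in>Poly_Mapping.keys p. Poly_Mapping.single m (Poly_Mapping.lookup p m)) = p"
proof (rule poly_mapping_eqI)
  fix k
  have "(\<Sum>m\<in>Poly_Mapping.keys p. Poly_Mapping.lookup p m when m = k) = Poly_Mapping.lookup p k"
    by (simp add: when_def in_keys_iff)
  then show "Poly_Mapping.lookup (\<Sum>m\<in>Poly_Mapping.keys p.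
      Poly_Mapping.single m (Poly_Mapping.lookup p m)) k = Poly_Mapping.lookup p k"
    by (simp add: lookup_sum lookup_single)
qed

text \<open>A polynomial is the finite sum of its terms. Membership of the partial sums in
  \<open>poly_on K\<close> is carried along, because the rule for addition requires it.\<close>

lemma poly_on_induct [consumes 1, case_names zero single add]:
  assumes "p \<in> poly_on K"
    and "Q 0"
    and "\<And>m c. m \<in> K \<Longrightarrow> Q (Poly_Mapping.single m c)"
    and "\<And>p p'. p \<in> poly_on K \<Longrightarrow> p' \<in> poly_on K \<Longrightarrow> Q p \<Longrightarrow> Q p' \<Longrightarrow> Q (p + p')"
  shows "Q p"
proof -
  let ?f = "\<lambda>m. Poly_Mapping.single m (Poly_Mapping.lookup p m)"
  have "Q (sum ?f M) \<and> sum ?f M \<in> poly_on K" if "finite M" "M \<subseteq> K" for M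
    using that
  proof (induction M)
    case empty
    then show ?case by (simp add: assms(2) poly_on_zero)
  next
    case (insert m M)
    then have m: "?f m \<in> poly_on K" "Q (?f m)" and M: "sum ?f M \<in> poly_on K" "Q (sum ?f M)"
      using assms(3) poly_on_single by auto
    then show ?case
      using insert.hyps assms(4)[OF m(1) M(1) m(2) M(2)] poly_on_add[OF m(1) M(1)] by simp
  qed
  from this[of "Poly_Mapping.keys p"] assms(1) show ?thesis
    by (simp add: sum_single_lookup poly_on_def)
qed

section \<open>Exponent vectors\<close>

definition weight :: "nat \<Rightarrow> nat \<Rightarrow> (nat \<Rightarrow>\<^sub>0 nat) \<Rightarrow> nat" where
  "weight q n m = (\<Sum>j=1..n. q ^ (j - 1) * Poly_Mapping.lookup m j)"

lemma weight_add: "weight q n (a + b) = weight q n a + weight q n b"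
  by (simp add: weight_def lookup_add algebra_simps sum.distrib)

lemma weight_zero [simp]: "weight q n 0 = 0"
  by (simp add: weight_def)

definition expvecs :: "nat \<Rightarrow> (nat \<Rightarrow>\<^sub>0 nat) set" where
  "expvecs n = {m. Poly_Mapping.keys m \<subseteq> {1..n}}"

lemma expvecs_add: "a \<in> expvecs n \<Longrightarrow> b \<in> expvecs n \<Longrightarrow> a + b \<in> expvecs n"
  using Poly_Mapping.keys_add[of a b] by (auto simp: expvecs_def)

definition zero_weight :: "nat \<Rightarrow> nat \<Rightarrow> nat \<Rightarrow> (nat \<Rightarrow>\<^sub>0 nat) set" where
  "zero_weight q n e = {m \<in> expvecs n. e dvd weight q n m}"

lemma zero_weight_add:
  "a \<in> zero_weight q n e \<Longrightarrow> b \<in> zero_weight q n e \<Longrightarrow> a + b \<in> zero_weight q n e"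
  by (simp add: zero_weight_def expvecs_add weight_add)

lemma zero_in_zero_weight: "0 \<in> zero_weight q n e"
  by (simp add: zero_weight_def expvecs_def)

text \<open>
  Sums of at least \<open>l\<close> nonzero vectors: for \<open>l = 0\<close> all of \<open>zero_weight\<close> is taken, to match
  \<open>J\<^sup>0 = A\<close>.
\<close>

fun factor_sums :: "nat \<Rightarrow> nat \<Rightarrow> nat \<Rightarrow> nat \<Rightarrow> (nat \<Rightarrow>\<^sub>0 nat) set" where
  "factor_sums q n e 0 = zero_weight q n e"
| "factor_sums q n e (Suc l) =
     {a + b | a b. a \<in> factor_sums q n e l \<and> b \<in> zero_weight q n e - {0}}"

text \<open>The extra vector is passed down to the base summand, which may be any vector in
  \<open>zero_weight q n e\<close>. This closure makes the sets decrease with \<open>l\<close> and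
  their spans ideals of the algebra.\<close>

lemma factor_sums_add:
  "a \<in> factor_sums q n e l \<Longrightarrow> b \<in> zero_weight q n e \<Longrightarrow> a + b \<in> factor_sums q n e l"
proof (induction l arbitrary: a)
  case (Suc l)
  from Suc.prems(1) obtain a' b' where ab: "a = a' + b'" "a' \<in> factor_sums q n e l"
    "b' \<in> zero_weight q n e - {0}" by auto
  have "a' + b \<in> factor_sums q n e l" using Suc.IH ab Suc.prems by blast
  then have "(a' + b) + b' \<in> factor_sums q n e (Suc l)" using ab(3) by auto
  then show ?case by (simp add: ab(1) ac_simps)
qed (simp add: zero_weight_add)

lemma factor_sums_Suc_subset: "factor_sums q n e (Suc l) \<subseteq> factor_sums q n e l"
  by (auto intro: factor_sums_add)

lemma factor_sums_subset: "factor_sums q n e l \<subseteq> zero_weight q n e"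
proof (induction l)
  case (Suc l)
  then show ?case using factor_sums_Suc_subset by blast
qed simp

text \<open>Entries are natural numbers, so nothing cancels and a sum with a nonzero summand is
  nonzero. The span of this set is the candidate for the radical.\<close>

lemma factor_sums_1: "factor_sums q n e (Suc 0) = zero_weight q n e - {0}"
proof
  show "factor_sums q n e (Suc 0) \<subseteq> zero_weight q n e - {0}"
  proof
    fix x assume "x \<in> factor_sums q n e (Suc 0)"
    then obtain a b where ab: "x = a + b" "a \<in> zero_weight q n e" "b \<in> zero_weight q n e" "b \<noteq> 0"
      by auto
    have "x \<noteq> 0"
    proof
      assume "x = 0"
      then have "Poly_Mapping.lookup b j = 0" for j
        using ab(1) by (metis add_is_0 lookup_add lookup_zero)
      then show False using ab(4) by (metis lookup_zero poly_mapping_eqI)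
    qed
    then show "x \<in> zero_weight q n e - {0}" using ab zero_weight_add by auto
  qed
  show "zero_weight q n e - {0} \<subseteq> factor_sums q n e (Suc 0)"
  proof
    fix x assume "x \<in> zero_weight q n e - {0}"
    then have "0 + x \<in> factor_sums q n e (Suc 0)"
      unfolding factor_sums.simps using zero_in_zero_weight by blast
    then show "x \<in> factor_sums q n e (Suc 0)" by simp
  qed
qed

lemma mvar_power: "mvar j ^ k = Poly_Mapping.single (Poly_Mapping.single j k) 1"
  by (induction k) (simp_all add: mvar_def mult_single flip: single_add)

declare factor_sums.simps(2) [simp del]

section \<open>Powers of the radical\<close>

context
  fixes F :: "'f::field itself" and q n e :: nat
begin

private abbreviation (input) "P \<equiv> mpoly_ring F n"
private abbreviation (input) "T \<equiv> trunc_ring F q n"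
private abbreviation (input) "cls \<equiv> trunc_class F q n"
private abbreviation (input) "A \<equiv> A_alg F q n e"
private abbreviation (input) "Z \<equiv> zero_weight q n e"
private abbreviation (input) "S \<equiv> factor_sums q n e"
private abbreviation (input) "outside \<equiv> {m \<in> expvecs n. \<exists>j\<in>{1..n}. q \<le> Poly_Mapping.lookup m j}"

section \<open>The polynomial ring and its truncation\<close>

lemma mpoly_ring_simps [simp]:
  "carrier P = poly_on (expvecs n)" "x \<otimes>\<^bsub>P\<^esub> y = x * y" "x \<oplus>\<^bsub>P\<^esub> y = x + y"
  "\<one>\<^bsub>P\<^esub> = 1" "\<zero>\<^bsub>P\<^esub> = 0"
  by (auto simp: mpoly_ring_def poly_on_def expvecs_def)

lemma one_mpoly: "1 \<in> poly_on (expvecs n)"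
  by (auto simp: poly_on_def expvecs_def)

lemma cring_mpoly: "cring P"
proof (rule cringI)
  show "abelian_group P"
  proof (rule abelian_groupI)
    fix x assume "x \<in> carrier P"
    then show "\<exists>y\<in>carrier P. y \<oplus>\<^bsub>P\<^esub> x = \<zero>\<^bsub>P\<^esub>"
      by (intro bexI[of _ "- x"]) (auto intro: poly_on_uminus)
  qed (auto intro: poly_on_add poly_on_zero)
  show "Group.comm_monoid P"
    by (rule comm_monoidI)
      (auto intro: poly_on_mult[OF _ _ expvecs_add] one_mpoly simp: algebra_simps)
qed (simp add: algebra_simps)

interpretation P: cring P by (rule cring_mpoly)

lemma minus_mpoly: "x \<in> carrier P \<Longrightarrow> \<ominus>\<^bsub>P\<^esub> x = - x"
  using P.minus_equality[of "- x" x] by (simp add: poly_on_uminus)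

lemma diff_mpoly: "x \<in> carrier P \<Longrightarrow> y \<in> carrier P \<Longrightarrow> x \<ominus>\<^bsub>P\<^esub> y = x - y"
  by (simp add: a_minus_def minus_mpoly)

lemma mvar_power_carrier: "j \<in> {1..n} \<Longrightarrow> mvar j ^ k \<in> carrier P"
  by (auto simp: mvar_power expvecs_def split: if_splits intro!: poly_on_single)

text \<open>Multiplication by a monomial never lowers an exponent, so an entry that has reached
  \<open>q\<close> stays there.\<close>

lemma ideal_poly_on_outside: "ideal (poly_on outside) P"
proof (rule idealI)
  show "ring P" by (rule P.ring_axioms)
  show "subgroup (poly_on outside) (add_monoid P)"
  proof
    fix x :: "(nat \<Rightarrow>\<^sub>0 nat) \<Rightarrow>\<^sub>0 'f" assume x: "x \<in> poly_on outside"
    then have "x \<in> carrier P" by (auto intro: poly_on_mono[of outside])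
    then have "inv\<^bsub>add_monoid P\<^esub> x = - x"
      using minus_mpoly by (simp add: a_inv_def)
    then show "inv\<^bsub>add_monoid P\<^esub> x \<in> poly_on outside" using x by (simp add: poly_on_uminus)
  qed (auto intro: poly_on_add poly_on_zero poly_on_mono[of outside])
  fix a x :: "(nat \<Rightarrow>\<^sub>0 nat) \<Rightarrow>\<^sub>0 'f"
  assume ax: "a \<in> poly_on outside" "x \<in> carrier P"
  have "a * x \<in> poly_on outside"
    by (rule poly_on_mult[of _ outside _ "expvecs n"])
      (use ax in \<open>auto simp: lookup_add intro!: expvecs_add trans_le_add1\<close>)
  then show "x \<otimes>\<^bsub>P\<^esub> a \<in> poly_on outside" "a \<otimes>\<^bsub>P\<^esub> x \<in> poly_on outside"
    by (simp_all add: mult.commute)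
qed

text \<open>A monomial with some exponent at least \<open>q\<close> is divisible by a generator; the
  other inclusion is minimality of the generated ideal.\<close>

lemma power_ideal_eq: "power_ideal F q n = poly_on outside"
proof
  have gens: "(\<lambda>j. mvar j ^ q) ` {1..n} \<subseteq> carrier P"
    using mvar_power_carrier by blast
  show "power_ideal F q n \<subseteq> poly_on outside"
    unfolding power_ideal_def
  proof (rule P.genideal_minimal[OF ideal_poly_on_outside])
    show "(\<lambda>j. mvar j ^ q) ` {1..n} \<subseteq> poly_on outside"
      unfolding mvar_power
      by (intro image_subsetI poly_on_single) (auto simp: expvecs_def split: if_splits intro!: bexI)
  qed
  interpret I: ideal "power_ideal F q n" P
    unfolding power_ideal_def by (rule P.genideal_ideal[OF gens])
  show "poly_on outside \<subseteq> power_ideal F q n"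
  proof
    fix p :: "(nat \<Rightarrow>\<^sub>0 nat) \<Rightarrow>\<^sub>0 'f" assume "p \<in> poly_on outside"
    then show "p \<in> power_ideal F q n"
    proof (induction rule: poly_on_induct)
      case zero
      then show ?case using I.zero_closed by simp
    next
      case (single m c)
      then obtain j where j: "j \<in> {1..n}" "q \<le> Poly_Mapping.lookup m j" and m: "m \<in> expvecs n"
        by blast
      let ?m = "m - Poly_Mapping.single j q"
      have "m = ?m + Poly_Mapping.single j q"
        using j(2) by (intro poly_mapping_eqI) (auto simp: lookup_add lookup_minus lookup_single when_def)
      then have "Poly_Mapping.single m c = Poly_Mapping.single ?m c * mvar j ^ q"
        by (simp add: mvar_power mult_single)
      moreover have "mvar j ^ q \<in> power_ideal F q n"
        unfolding power_ideal_def using P.genideal_self[OF gens] j(1) by blast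
      moreover have "?m \<in> expvecs n"
        using m by (auto simp: expvecs_def in_keys_iff lookup_minus)
      ultimately show ?case
        using I.I_l_closed[of "mvar j ^ q" "Poly_Mapping.single ?m c"]
        by (simp add: poly_on_single)
    next
      case (add p p')
      then show ?case using I.a_closed by simp
    qed
  qed
qed

interpretation I: ideal "power_ideal F q n" P
  unfolding power_ideal_eq by (rule ideal_poly_on_outside)

interpretation T: cring T
  unfolding trunc_ring_def by (rule I.quotient_is_cring[OF cring_mpoly])

lemma trunc_class_hom: "ring_hom_ring P T cls"
proof -
  have "cls = (+>\<^bsub>P\<^esub>) (power_ideal F q n)"
    by (auto simp: trunc_class_def)
  then show ?thesis
    using I.rcos_ring_hom_ring by (simp add: trunc_ring_def)
qed

interpretation h: ring_hom_ring P T cls by (rule trunc_class_hom)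

lemma trunc_class_eq_iff:
  "p \<in> carrier P \<Longrightarrow> p' \<in> carrier P \<Longrightarrow> cls p = cls p' \<longleftrightarrow> p - p' \<in> poly_on outside"
  using P.quotient_eq_iff_same_a_r_cos[OF I.is_ideal, of p p']
  by (simp add: trunc_class_def diff_mpoly power_ideal_eq)

lemma trunc_class_eq_zero_iff:
  "p \<in> carrier P \<Longrightarrow> cls p = \<zero>\<^bsub>T\<^esub> \<longleftrightarrow> p \<in> poly_on outside"
  using trunc_class_eq_iff[of p 0] h.hom_zero by (simp add: poly_on_zero)

lemma trunc_monomial_eq:
  "trunc_monomial F q n i
    = cls (Poly_Mapping.single (\<Sum>j=1..n. Poly_Mapping.single j (i j)) 1)"
proof -
  have cl: "cls (mvar j) \<in> carrier T" if "j \<in> {1..n}" for j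
    using mvar_power_carrier[OF that, of 1] by simp
  have pw: "cls (mvar j) [^]\<^bsub>T\<^esub> k = cls (mvar j ^ k)" if "j \<in> {1..n}" for j k
  proof (induction k)
    case 0
    then show ?case using h.hom_one by simp
  next
    case (Suc k)
    then show ?case
      using h.hom_mult[OF mvar_power_carrier[OF that, of k] mvar_power_carrier[OF that, of 1]]
      by (simp add: mult.commute)
  qed
  \<comment> \<open>The induction runs over partial products. Membership in \<open>expvecs n\<close>
    is part of the claim since \<open>cls\<close> is known to be multiplicative only on the
    carrier.\<close>
  have "(\<Otimes>\<^bsub>T\<^esub>j\<in>B. cls (mvar j) [^]\<^bsub>T\<^esub> i j)
      = cls (Poly_Mapping.single (\<Sum>j\<in>B. Poly_Mapping.single j (i j)) 1)
    \<and> (\<Sum>j\<in>B. Poly_Mapping.single j (i j)) \<in> expvecs n" if "finite B" "B \<subseteq> {1..n}" for B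
    using that
  proof (induction B)
    case empty
    then show ?case using h.hom_one by (simp add: expvecs_def)
  next
    case (insert j B)
    let ?s = "\<Sum>j\<in>B. Poly_Mapping.single j (i j)"
    have j: "j \<in> {1..n}" and s: "?s \<in> expvecs n" using insert by auto
    have "(\<Otimes>\<^bsub>T\<^esub>j\<in>insert j B. cls (mvar j) [^]\<^bsub>T\<^esub> i j)
        = cls (mvar j) [^]\<^bsub>T\<^esub> i j \<otimes>\<^bsub>T\<^esub> (\<Otimes>\<^bsub>T\<^esub>j\<in>B. cls (mvar j) [^]\<^bsub>T\<^esub> i j)"
      using insert cl by (intro T.finprod_insert) auto
    also have "\<dots> = cls (mvar j ^ i j * Poly_Mapping.single ?s 1)"
      using insert j h.hom_mult[OF mvar_power_carrier[OF j], of "Poly_Mapping.single ?s 1"] s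
      by (simp add: pw poly_on_single)
    finally show ?case
      using insert j s expvecs_add[of "Poly_Mapping.single j (i j)" n ?s]
      by (simp add: mvar_power mult_single expvecs_def)
  qed
  then show ?thesis by (simp add: trunc_monomial_def)
qed

section \<open>The algebra as a span of monomials\<close>

lemma zero_weight_poly_carrier: "poly_on Z \<subseteq> carrier P"
  by (auto simp: zero_weight_def intro: poly_on_mono[of Z "expvecs n"])

lemma factor_sums_poly_carrier: "poly_on (S l) \<subseteq> carrier P"
  using zero_weight_poly_carrier poly_on_mono[OF factor_sums_subset] by blast

lemma A_alg_simps [simp]:
  "x \<otimes>\<^bsub>A\<^esub> y = x \<otimes>\<^bsub>T\<^esub> y" "x \<oplus>\<^bsub>A\<^esub> y = x \<oplus>\<^bsub>T\<^esub> y" "\<one>\<^bsub>A\<^esub> = \<one>\<^bsub>T\<^esub>" "\<zero>\<^bsub>A\<^esub> = \<zero>\<^bsub>T\<^esub>"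
  by (simp_all add: A_alg_def)

lemma one_poly_zero_weight: "1 \<in> poly_on Z"
  by (simp add: poly_on_def zero_in_zero_weight)

lemma subring_zero_weight: "subring (cls ` poly_on Z) T"
proof (rule T.subringI)
  show "cls ` poly_on Z \<subseteq> carrier T"
    using zero_weight_poly_carrier h.hom_closed by blast
  show "\<one>\<^bsub>T\<^esub> \<in> cls ` poly_on Z"
    using h.hom_one one_poly_zero_weight by force
  fix x y assume "x \<in> cls ` poly_on Z" "y \<in> cls ` poly_on Z"
  then obtain p p' where p: "x = cls p" "p \<in> poly_on Z" "y = cls p'" "p' \<in> poly_on Z" by auto
  then have c: "p \<in> carrier P" "p' \<in> carrier P" using zero_weight_poly_carrier by auto
  show "\<ominus>\<^bsub>T\<^esub> x \<in> cls ` poly_on Z"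
    using h.hom_a_inv[OF c(1)] p(1) poly_on_uminus[OF p(2)] minus_mpoly[OF c(1)] by force
  show "x \<otimes>\<^bsub>T\<^esub> y \<in> cls ` poly_on Z"
    using h.hom_mult[OF c] p poly_on_mult[OF p(2,4) zero_weight_add] by force
  show "x \<oplus>\<^bsub>T\<^esub> y \<in> cls ` poly_on Z"
    using h.hom_add[OF c] p poly_on_add[OF p(2,4)] by force
qed

text \<open>Weights are additive, so the span of the monomials of weight zero modulo
  \<open>e\<close> is a subring, and it contains the generators. Conversely, each of its terms is a
  constant times a generating monomial.\<close>

lemma carrier_A_alg: "carrier A = cls ` poly_on Z"
proof -
  let ?G = "range (\<lambda>c. cls (mconst c)) \<union>
        {trunc_monomial F q n i | i. [(\<Sum>j=1..n. q ^ (j - 1) * i j) = 0] (mod e)}"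
  have lk: "Poly_Mapping.lookup (\<Sum>j=1..n. Poly_Mapping.single j (i j)) k
      = (if k \<in> {1..n} then i k else 0)" for i :: "nat \<Rightarrow> nat" and k
    by (simp add: lookup_sum lookup_single when_def)
  have wt: "weight q n (\<Sum>j=1..n. Poly_Mapping.single j (i j)) = (\<Sum>j=1..n. q ^ (j - 1) * i j)"
    for i :: "nat \<Rightarrow> nat"
    unfolding weight_def using lk[of i] by (intro sum.cong) (simp_all del: One_nat_def)
  have vec: "(\<Sum>j=1..n. Poly_Mapping.single j (i j)) \<in> expvecs n" for i :: "nat \<Rightarrow> nat"
    unfolding expvecs_def using lk[of i] by (auto simp: in_keys_iff simp del: One_nat_def split: if_splits)
  have sub: "?G \<subseteq> cls ` poly_on Z"
    using wt vec zero_in_zero_weight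
    by (auto simp: trunc_monomial_eq mconst_def zero_weight_def cong_0_iff intro!: imageI poly_on_single)
  have "generate_ring T ?G = cls ` poly_on Z"
  proof
    have "cls ` poly_on Z \<subseteq> carrier T" using subringE(1)[OF subring_zero_weight] .
    with sub show "generate_ring T ?G \<subseteq> cls ` poly_on Z"
      by (intro T.generate_ring_min_subring1 subring_zero_weight) (rule order_trans)
    show "cls ` poly_on Z \<subseteq> generate_ring T ?G"
    proof
      fix x assume "x \<in> cls ` poly_on Z"
      then obtain p where x: "x = cls p" and "p \<in> poly_on Z" by blast
      from this(2) have "cls p \<in> generate_ring T ?G"
      proof (induction rule: poly_on_induct)
        case zero
        then show ?case using h.hom_zero T.zero_in_generate by simp
      next
        case (single m c)
        let ?i = "Poly_Mapping.lookup m"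
        have m: "(\<Sum>j=1..n. Poly_Mapping.single j (?i j)) = m"
          using single lk[of ?i]
          by (intro poly_mapping_eqI) (auto simp: zero_weight_def expvecs_def in_keys_iff simp del: One_nat_def)
        then have "cls (Poly_Mapping.single m 1) = trunc_monomial F q n ?i"
          by (simp add: trunc_monomial_eq)
        then have "cls (Poly_Mapping.single m 1) \<in> ?G"
          using single by (auto simp: zero_weight_def weight_def cong_0_iff)
        moreover have "cls (mconst c) \<in> ?G" by blast
        moreover have "cls (Poly_Mapping.single m c)
            = cls (mconst c) \<otimes>\<^bsub>T\<^esub> cls (Poly_Mapping.single m 1)"
        proof -
          have "mconst c \<in> carrier P" "Poly_Mapping.single m 1 \<in> carrier P"
            using single zero_in_zero_weight[of q n e]
            by (auto simp: mconst_def zero_weight_def intro!: poly_on_single)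
          from h.hom_mult[OF this] show ?thesis by (simp add: mconst_def mult_single)
        qed
        ultimately show ?case
          by (metis (no_types, lifting) generate_ring.eng_mult generate_ring.incl)
      next
        case (add p p')
        have "p \<in> carrier P" "p' \<in> carrier P" using add zero_weight_poly_carrier by auto
        from h.hom_add[OF this] add show ?case by (simp add: generate_ring.eng_add)
      qed
      then show "x \<in> generate_ring T ?G" by (simp add: x)
    qed
  qed
  then show ?thesis by (simp add: A_alg_def)
qed

lemma cring_A_alg: "cring A"
proof -
  have "A = T\<lparr>carrier := cls ` poly_on Z\<rparr>"
    using carrier_A_alg by (simp add: A_alg_def)
  then show ?thesis
    using T.subcringI'[OF subring_zero_weight] T.subcring_iff[of "cls ` poly_on Z"]
      subringE(1)[OF subring_zero_weight] by simp
qed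

interpretation A: cring A by (rule cring_A_alg)

lemma trunc_class_mult:
  "p \<in> poly_on Z \<Longrightarrow> p' \<in> poly_on Z \<Longrightarrow> cls p \<otimes>\<^bsub>T\<^esub> cls p' = cls (p * p')"
  using h.hom_mult[of p p'] zero_weight_poly_carrier by auto

lemma trunc_class_add:
  "p \<in> poly_on Z \<Longrightarrow> p' \<in> poly_on Z \<Longrightarrow> cls p \<oplus>\<^bsub>T\<^esub> cls p' = cls (p + p')"
  using h.hom_add[of p p'] zero_weight_poly_carrier by auto

lemma A_alg_minus:
  assumes "p \<in> poly_on Z" shows "\<ominus>\<^bsub>A\<^esub> cls p = cls (- p)"
  using A.minus_equality[of "cls (- p)" "cls p"] trunc_class_add[of "- p" p] assms h.hom_zero
  by (auto simp: poly_on_uminus carrier_A_alg)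

lemma factor_sums_poly: "p \<in> poly_on (S l) \<Longrightarrow> p \<in> poly_on Z"
  using poly_on_mono[OF factor_sums_subset] .

section \<open>Products of ideals spanned by monomials\<close>

lemma ideal_factor_sums: "ideal (cls ` poly_on (S l)) A"
proof (rule idealI)
  show "ring A" by (rule A.ring_axioms)
  show "subgroup (cls ` poly_on (S l)) (add_monoid A)"
  proof
    show "cls ` poly_on (S l) \<subseteq> carrier (add_monoid A)"
      by (auto simp: carrier_A_alg dest: factor_sums_poly)
    show "\<one>\<^bsub>add_monoid A\<^esub> \<in> cls ` poly_on (S l)"
      using h.hom_zero poly_on_zero by force
    fix x assume x: "x \<in> cls ` poly_on (S l)"
    then obtain p where p: "x = cls p" "p \<in> poly_on (S l)" by auto
    from A_alg_minus[OF factor_sums_poly[OF p(2)]] p poly_on_uminus[OF p(2)]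
    show "inv\<^bsub>add_monoid A\<^esub> x \<in> cls ` poly_on (S l)" by (simp add: a_inv_def)
    fix y assume "y \<in> cls ` poly_on (S l)"
    then obtain p' where p': "y = cls p'" "p' \<in> poly_on (S l)" by auto
    show "x \<otimes>\<^bsub>add_monoid A\<^esub> y \<in> cls ` poly_on (S l)"
      using trunc_class_add[OF p(2)[THEN factor_sums_poly] p'(2)[THEN factor_sums_poly]]
        poly_on_add[OF p(2) p'(2)] p(1) p'(1) by simp
  qed
  fix a x assume "a \<in> cls ` poly_on (S l)" "x \<in> carrier A"
  then obtain p p' where p: "a = cls p" "p \<in> poly_on (S l)" "x = cls p'" "p' \<in> poly_on Z"
    by (auto simp: carrier_A_alg)
  have "p * p' \<in> poly_on (S l)" by (rule poly_on_mult[OF p(2,4) factor_sums_add])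
  then show "x \<otimes>\<^bsub>A\<^esub> a \<in> cls ` poly_on (S l)" "a \<otimes>\<^bsub>A\<^esub> x \<in> cls ` poly_on (S l)"
    using p factor_sums_poly[OF p(2)] by (simp_all add: trunc_class_mult mult.commute)
qed

lemma mult_factor_sums:
  assumes "p \<in> poly_on (S l)" "p' \<in> poly_on (S (Suc 0))"
  shows "p * p' \<in> poly_on (S (Suc l))"
proof (rule poly_on_mult[OF assms])
  fix a b assume "a \<in> S l" "b \<in> S (Suc 0)"
  then show "a + b \<in> S (Suc l)" by (auto simp: factor_sums_1 factor_sums.simps(2)[of _ _ _ l])
qed

text \<open>For the inclusion from right to left, a vector in \<open>S (Suc l)\<close> splits by
  definition into one from \<open>S l\<close> and a nonzero one of weight zero; the coefficient goes
  to the first factor.\<close>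

lemma ideal_prod_factor_sums:
  "cls ` poly_on (S l) \<cdot>\<^bsub>A\<^esub> cls ` poly_on (S (Suc 0)) = cls ` poly_on (S (Suc l))"
    (is "?L = ?R")
proof
  show "?L \<subseteq> ?R"
  proof
    fix x assume "x \<in> ?L"
    then show "x \<in> ?R"
    proof (induction rule: ideal_prod.induct)
      case (prod i j)
      then obtain p p' where p: "i = cls p" "p \<in> poly_on (S l)" "j = cls p'" "p' \<in> poly_on (S (Suc 0))"
        by blast
      then have "i \<otimes>\<^bsub>A\<^esub> j = cls (p * p')"
        using factor_sums_poly[OF p(2)] factor_sums_poly[OF p(4)] by (simp add: trunc_class_mult)
      with mult_factor_sums[OF p(2,4)] show ?case by blast
    next
      case (sum s1 s2)
      from sum.IH obtain p p' where p: "s1 = cls p" "p \<in> poly_on (S (Suc l))"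
        "s2 = cls p'" "p' \<in> poly_on (S (Suc l))" by blast
      then have "s1 \<oplus>\<^bsub>A\<^esub> s2 = cls (p + p')"
        using factor_sums_poly[OF p(2)] factor_sums_poly[OF p(4)] by (simp add: trunc_class_add)
      with poly_on_add[OF p(2,4)] show ?case by blast
    qed
  qed
  show "?R \<subseteq> ?L"
  proof
    fix x assume "x \<in> ?R"
    then obtain p where x: "x = cls p" and "p \<in> poly_on (S (Suc l))" by blast
    from this(2) have "cls p \<in> ?L"
    proof (induction rule: poly_on_induct)
      case zero
      \<comment> \<open>An ideal product is built from products and sums only, so zero has to be
        exhibited as a product.\<close>
      have "cls 0 \<otimes>\<^bsub>A\<^esub> cls 0 \<in> ?L" by (intro ideal_prod.prod imageI poly_on_zero)
      then show ?case by (simp add: trunc_class_mult poly_on_zero)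
    next
      case (single m c)
      then obtain a b where m: "m = a + b" "a \<in> S l" "b \<in> S (Suc 0)"
        using factor_sums_1 by (auto simp: factor_sums.simps(2)[of _ _ _ l])
      then have "Poly_Mapping.single a c \<in> poly_on (S l)"
        "Poly_Mapping.single b 1 \<in> poly_on (S (Suc 0))" by (auto intro: poly_on_single)
      then have "cls (Poly_Mapping.single a c) \<otimes>\<^bsub>A\<^esub> cls (Poly_Mapping.single b 1) \<in> ?L"
        "Poly_Mapping.single a c \<in> poly_on Z" "Poly_Mapping.single b (1::'f) \<in> poly_on Z"
        by (auto intro: ideal_prod.prod factor_sums_poly simp del: A_alg_simps)
      then show ?case by (simp add: trunc_class_mult mult_single m(1))
    next
      case (add p p')
      from add.IH have "cls p \<oplus>\<^bsub>A\<^esub> cls p' \<in> ?L" by (rule ideal_prod.sum)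
      then show ?case
        using trunc_class_add[OF add.hyps[THEN factor_sums_poly]] by simp
    qed
    then show "x \<in> ?L" by (simp add: x)
  qed
qed

lemma ideal_power_factor_sums:
  "cls ` poly_on (S (Suc 0)) [^]\<^bsub>ideals_set A\<^esub> l = cls ` poly_on (S l)"
proof (induction l)
  case 0
  then show ?case by (simp add: ideals_set_def carrier_A_alg)
next
  case (Suc l)
  have "cls ` poly_on (S (Suc 0)) [^]\<^bsub>ideals_set A\<^esub> Suc l
      = cls ` poly_on (S l) \<cdot>\<^bsub>A\<^esub> cls ` poly_on (S (Suc 0))"
    using Suc by (simp add: ideals_set_def)
  then show ?case using ideal_prod_factor_sums by simp
qed

section \<open>The radical and the Loewy length\<close>

lemma trunc_class_factor_sums_eq_zero_iff:
  "cls ` poly_on (S l) = {\<zero>\<^bsub>A\<^esub>} \<longleftrightarrow> S l \<subseteq> outside"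
proof
  assume L: "cls ` poly_on (S l) = {\<zero>\<^bsub>A\<^esub>}"
  show "S l \<subseteq> outside"
  proof
    \<comment> \<open>The kernel of \<open>cls\<close> is spanned by monomials, so each exponent
      vector can be tested on its own monomial.\<close>
    fix m assume "m \<in> S l"
    then have s: "Poly_Mapping.single m (1::'f) \<in> poly_on (S l)" by (rule poly_on_single)
    then have "cls (Poly_Mapping.single m 1) = \<zero>\<^bsub>T\<^esub>" using L by auto
    then have "Poly_Mapping.single m (1::'f) \<in> poly_on outside"
      using trunc_class_eq_zero_iff s factor_sums_poly_carrier by blast
    then show "m \<in> outside" by (simp add: poly_on_def)
  qed
next
  assume R: "S l \<subseteq> outside"
  have "cls p = \<zero>\<^bsub>T\<^esub>" if "p \<in> poly_on (S l)" for p
    using trunc_class_eq_zero_iff that factor_sums_poly_carrier poly_on_mono[OF R that] by blast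
  then show "cls ` poly_on (S l) = {\<zero>\<^bsub>A\<^esub>}" using poly_on_zero by force
qed

text \<open>\<open>poly_on (S (Suc 0))\<close> consists of the polynomials in \<open>poly_on Z\<close> without constant term.\<close>

lemma maximalideal_factor_sums:
  assumes "q > 0"
  shows "maximalideal (cls ` poly_on (S (Suc 0))) A" (is "maximalideal ?J A")
proof (rule maximalidealI)
  show "ideal ?J A" by (rule ideal_factor_sums)
  show "carrier A \<noteq> ?J"
  proof
    assume "carrier A = ?J"
    then have "cls 1 \<in> ?J" using one_poly_zero_weight carrier_A_alg by blast
    then obtain p where p: "cls 1 = cls p" "p \<in> poly_on (S (Suc 0))" by blast
    \<comment> \<open>The difference \<open>1 - p\<close> has constant term 1, but the zero vector
      has no entry reaching \<open>q\<close>, because \<open>q > 0\<close>.\<close>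
    then have "1 - p \<in> poly_on outside"
      using trunc_class_eq_iff[of 1 p] one_mpoly factor_sums_poly_carrier[of "Suc 0"] by auto
    moreover have "0 \<notin> Poly_Mapping.keys p"
      using p(2) by (auto simp: poly_on_def factor_sums_1)
    then have "0 \<in> Poly_Mapping.keys (1 - p)"
      by (simp add: in_keys_iff lookup_minus)
    ultimately show False using assms by (auto simp: poly_on_def)
  qed
next
  fix K assume K: "ideal K A" "?J \<subseteq> K" "K \<subseteq> carrier A"
  interpret K: ideal K A by fact
  show "K = ?J \<or> K = carrier A"
  proof (rule disjCI)
    assume "K \<noteq> carrier A"
    show "K = ?J"
    proof (rule ccontr)
      assume "K \<noteq> ?J"
      with K(2) obtain x where x: "x \<in> K" "x \<notin> ?J" by blast
      with K(3) have "x \<in> cls ` poly_on Z" unfolding carrier_A_alg by blast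
      with x obtain p where p: "p \<in> poly_on Z" "cls p \<in> K" "cls p \<notin> ?J" by blast
      \<comment> \<open>As \<open>p\<close> differs from its constant term by an element of
        \<open>?J\<close>, this term is nonzero and its class lies in \<open>K\<close>; it is a
        unit.\<close>
      define c where "c = Poly_Mapping.lookup p 0"
      let ?c = "Poly_Mapping.single 0 c :: (nat \<Rightarrow>\<^sub>0 nat) \<Rightarrow>\<^sub>0 'f"
      have cZ: "Poly_Mapping.single 0 d \<in> poly_on Z" for d :: 'f
        by (simp add: zero_in_zero_weight poly_on_single)
      have "c \<noteq> 0"
        using p by (auto simp: c_def poly_on_def factor_sums_1 in_keys_iff)
      have "p - ?c \<in> poly_on Z" by (intro poly_on_diff p cZ)
      moreover have "0 \<notin> Poly_Mapping.keys (p - ?c)"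
        by (simp add: in_keys_iff lookup_minus c_def)
      ultimately have d: "p - ?c \<in> poly_on (S (Suc 0))"
        by (auto simp: poly_on_def factor_sums_1)
      then have "cls (- (p - ?c)) \<in> K" using K(2) poly_on_uminus by blast
      then have "cls p \<oplus>\<^bsub>A\<^esub> cls (- (p - ?c)) \<in> K" by (intro K.a_closed p)
      then have "cls ?c \<in> K"
        using trunc_class_add[OF p(1) poly_on_uminus[OF factor_sums_poly[OF d]]] by simp
      then have "cls (Poly_Mapping.single 0 (1 / c)) \<otimes>\<^bsub>A\<^esub> cls ?c \<in> K"
        using cZ carrier_A_alg by (intro K.I_l_closed) auto
      then have "\<one>\<^bsub>A\<^esub> \<in> K"
        using \<open>c \<noteq> 0\<close> h.hom_one by (simp add: trunc_class_mult cZ mult_single)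
      with K.one_imp_carrier \<open>K \<noteq> carrier A\<close> show False by blast
    qed
  qed
qed

text \<open>The second assumption makes \<open>?J\<close> nilpotent, so it lies in every maximal
  ideal, these being prime. Since \<open>?J\<close> is itself maximal, it also contains their
  intersection.\<close>

lemma jacobson_radical_A_alg:
  assumes "q > 0" "S l \<subseteq> outside"
  shows "jacobson_radical A = cls ` poly_on (S (Suc 0))" (is "_ = ?J")
proof -
  have "?J \<subseteq> M" if "maximalideal M A" for M
  proof
    interpret M: primeideal M A using A.maximalideal_prime[OF that] .
    fix x assume x: "x \<in> ?J"
    then have xc: "x \<in> carrier A" using factor_sums_poly[of _ "Suc 0"] carrier_A_alg by blast
    have "x [^]\<^bsub>A\<^esub> k \<in> cls ` poly_on (S k)" for k :: nat
    proof (induction k)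
      case 0
      then show ?case using A.one_closed carrier_A_alg by simp
    next
      case (Suc k)
      then show ?case
        using ideal_prod.prod[OF Suc x, of A] by (simp add: ideal_prod_factor_sums del: A_alg_simps)
    qed
    moreover have "cls ` poly_on (S l) \<subseteq> M"
      using trunc_class_factor_sums_eq_zero_iff[THEN iffD2, OF assms(2)] M.zero_closed by simp
    ultimately have "x [^]\<^bsub>A\<^esub> l \<in> M" by blast
    moreover have "x [^]\<^bsub>A\<^esub> k \<in> M \<longrightarrow> x \<in> M" for k :: nat
    proof (induction k)
      case 0
      then show ?case using M.one_imp_carrier M.I_notcarr by auto
    next
      case (Suc k)
      then show ?case using M.I_prime[of "x [^]\<^bsub>A\<^esub> k" x] xc A.nat_pow_closed
        by (auto simp del: A_alg_simps)
    qed
    ultimately show "x \<in> M" by blast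
  qed
  with maximalideal_factor_sums[OF assms(1)] show ?thesis
    using ideal.Icarr[OF ideal_factor_sums[of "Suc 0"]]
    unfolding jacobson_radical_def by blast
qed

text \<open>The sets \<open>S l\<close> decrease, so two neighbouring values of \<open>l\<close>
  locate the first vanishing power. The assumption on \<open>S (Suc k)\<close> also supplies the
  nilpotency needed to identify the radical.\<close>

lemma loewy_length_A_alg:
  assumes "q > 0" "S (Suc k) \<subseteq> outside" "\<not> S k \<subseteq> outside"
  shows "loewy_length A = Suc k"
proof -
  have eq: "jacobson_radical A [^]\<^bsub>ideals_set A\<^esub> l = {\<zero>\<^bsub>A\<^esub>} \<longleftrightarrow> S l \<subseteq> outside" for l
    unfolding jacobson_radical_A_alg[OF assms(1,2)] ideal_power_factor_sums
    by (rule trunc_class_factor_sums_eq_zero_iff)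
  have "Suc k \<le> l" if "S l \<subseteq> outside" for l
  proof (rule ccontr)
    assume "\<not> Suc k \<le> l"
    then have "l \<le> k" by simp
    then have "S k \<subseteq> S l"
      by (rule lift_Suc_antimono_le[of S, OF factor_sums_Suc_subset])
    with that assms(3) show False by blast
  qed
  with assms(2) show ?thesis
    unfolding loewy_length_def eq by (intro Least_equality)
qed

end

section \<open>The case \<open>q = 5\<close>, \<open>e = 33\<close>\<close>

text \<open>The function \<open>f\<close> is read as a multiset of indices, listed with
  multiplicity; one list serves all weights \<open>w\<close>. A weight of small degree
  \<open>d\<close> thereby becomes an explicit sum of \<open>d\<close> powers of 5.\<close>

lemma weighted_sum_as_list:
  fixes f :: "nat \<Rightarrow> nat"
  assumes "(\<Sum>i<h. f i) = d"
  shows "\<exists>xs. length xs = d \<and> (\<forall>w :: nat \<Rightarrow> nat. (\<Sum>i<h. w i * f i) = (\<Sum>x\<leftarrow>xs. w x))"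
  using assms
proof (induction h arbitrary: d)
  case (Suc h)
  obtain xs where xs: "length xs = (\<Sum>i<h. f i)"
    "\<forall>w :: nat \<Rightarrow> nat. (\<Sum>i<h. w i * f i) = (\<Sum>x\<leftarrow>xs. w x)" using Suc.IH by blast
  show ?case
    using xs Suc.prems
    by (intro exI[of _ "xs @ replicate (f h) h"]) (simp add: sum_list_replicate)
qed simp

text \<open>The powers of 5 represent exactly the nonzero squares modulo 11, and -1 is not a square.\<close>

lemma power_5_mod_11: "(5::nat) ^ i mod 11 \<in> {1, 3, 4, 5, 9}"
proof (induction i)
  case (Suc i)
  have "(5::nat) ^ Suc i mod 11 = (5 * (5 ^ i mod 11)) mod 11" by (simp add: mod_mult_right_eq)
  with Suc show ?case by auto
qed simp

lemma not_11_dvd_two_powers_5: "\<not> 11 dvd (5::nat) ^ i + 5 ^ j"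
proof -
  have "((5::nat) ^ i + 5 ^ j) mod 11 = (5 ^ i mod 11 + 5 ^ j mod 11) mod 11" by (simp add: mod_add_eq)
  with power_5_mod_11[of i] power_5_mod_11[of j] show ?thesis
    unfolding dvd_eq_mod_eq_0 by auto
qed

section \<open>The number m(5,33)\<close>

lemma m_number_5_33: "m_number 5 33 = 3"
  unfolding m_number_def
proof (rule Least_equality)
  have "{1..3} = {1, 2, 3::nat}" by auto
  \<comment> \<open>The witness is 1 + 1 + 5^4 = 627 = 33 * 19.\<close>
  then have "33 dvd (\<Sum>k=1..3. 5 ^ (if k = (3::nat) then 4 else 0) :: nat)"
    by simp
  then show "0 < (3::nat) \<and> (\<exists>i. 33 dvd (\<Sum>k=1..(3::nat). 5 ^ i k :: nat))"
    by (intro conjI exI[of _ "\<lambda>k::nat. if k = 3 then 4 else 0"]) simp_all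
next
  fix t :: nat
  assume "0 < t \<and> (\<exists>i :: nat \<Rightarrow> nat. (33::nat) dvd (\<Sum>k=1..t. 5 ^ i k))"
  then obtain i where t: "0 < t" "33 dvd (\<Sum>k=1..t. 5 ^ i k :: nat)" by blast
  \<comment> \<open>The factor 11 of 33 alone excludes one or two summands.\<close>
  from dvd_trans[OF _ t(2), of 11] have d: "11 dvd (\<Sum>k=1..t. 5 ^ i k :: nat)" by simp
  show "3 \<le> t"
  proof (rule ccontr)
    assume "\<not> 3 \<le> t"
    with t(1) consider "t = 1" | "t = 2" by linarith
    then show False
    proof cases
      case 1
      with d power_5_mod_11[of "i 1"] show False by (auto simp: dvd_eq_mod_eq_0)
    next
      case 2
      with d not_11_dvd_two_powers_5[of "i 1" "i 2"] show False by (simp add: numeral_2_eq_2)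
    qed
  qed
qed

section \<open>Degrees and weights on the two parity classes\<close>

text \<open>For \<open>n = 2 * h\<close>, positions with odd index carry the even powers of 5, and conversely.\<close>

definition even_deg :: "nat \<Rightarrow> (nat \<Rightarrow>\<^sub>0 nat) \<Rightarrow> nat" where
  "even_deg h m = (\<Sum>i<h. Poly_Mapping.lookup m (2 * i + 1))"

definition odd_deg :: "nat \<Rightarrow> (nat \<Rightarrow>\<^sub>0 nat) \<Rightarrow> nat" where
  "odd_deg h m = (\<Sum>i<h. Poly_Mapping.lookup m (2 * i + 2))"

definition even_weight :: "nat \<Rightarrow> (nat \<Rightarrow>\<^sub>0 nat) \<Rightarrow> nat" where
  "even_weight h m = (\<Sum>i<h. 5 ^ (2 * i) * Poly_Mapping.lookup m (2 * i + 1))"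

definition odd_weight :: "nat \<Rightarrow> (nat \<Rightarrow>\<^sub>0 nat) \<Rightarrow> nat" where
  "odd_weight h m = (\<Sum>i<h. 5 ^ (2 * i + 1) * Poly_Mapping.lookup m (2 * i + 2))"

lemma deg_weight_add:
  "even_deg h (a + b) = even_deg h a + even_deg h b"
  "odd_deg h (a + b) = odd_deg h a + odd_deg h b"
  "even_weight h (a + b) = even_weight h a + even_weight h b"
  "odd_weight h (a + b) = odd_weight h a + odd_weight h b"
  by (simp_all add: even_deg_def odd_deg_def even_weight_def odd_weight_def lookup_add
      algebra_simps sum.distrib)

lemma weight_eq: "weight 5 (2 * h) m = even_weight h m + odd_weight h m"
  unfolding weight_def even_weight_def odd_weight_def by (induction h) simp_all

text \<open>Even powers of 5 are 1 and odd ones are 2 modulo 3, so modulo 3 a weight depends only on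
  the degrees on the two classes.\<close>

lemma power_25_cong: "[(5::nat) ^ (2 * i) = 1] (mod 3)"
  using cong_pow[of "25::nat" 1 3 i] by (simp add: power_mult cong_def)

lemma even_weight_cong: "[even_weight h m = even_deg h m] (mod 3)"
  unfolding even_weight_def even_deg_def
  using cong_scalar_right[OF power_25_cong] by (intro cong_sum) simp

lemma odd_weight_cong: "[odd_weight h m = 2 * odd_deg h m] (mod 3)"
proof -
  have "[(5::nat) ^ (2 * i + 1) = 2] (mod 3)" for i
    using cong_scalar_left[OF power_25_cong[of i], of 5] by (simp add: cong_def)
  then show ?thesis
    unfolding odd_weight_def odd_deg_def sum_distrib_left by (intro cong_sum cong_scalar_right)
qed

lemma even_weight_small:
  "even_deg h m = 0 \<Longrightarrow> even_weight h m = 0"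
  "even_deg h m = 1 \<Longrightarrow> \<exists>i. even_weight h m = 5 ^ i"
  "even_deg h m = 2 \<Longrightarrow> \<exists>i j. even_weight h m = 5 ^ i + 5 ^ j"
proof -
  obtain xs where xs: "length xs = even_deg h m" "even_weight h m = (\<Sum>x\<leftarrow>xs. 5 ^ (2 * x))"
    using weighted_sum_as_list[OF even_deg_def[symmetric, of m h]] unfolding even_weight_def by metis
  show "even_deg h m = 0 \<Longrightarrow> even_weight h m = 0"
    using xs by simp
  show "even_deg h m = 1 \<Longrightarrow> \<exists>i. even_weight h m = 5 ^ i"
    using xs by (auto simp: length_Suc_conv)
  assume "even_deg h m = 2"
  with xs(1) obtain x y where "xs = [x, y]" by (auto simp: length_Suc_conv numeral_2_eq_2)
  with xs(2) have "even_weight h m = 5 ^ (2 * x) + 5 ^ (2 * y)" by simp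
  then show "\<exists>i j. even_weight h m = 5 ^ i + 5 ^ j" by blast
qed

lemma odd_weight_small:
  "odd_deg h m = 0 \<Longrightarrow> odd_weight h m = 0"
  "odd_deg h m = 1 \<Longrightarrow> \<exists>i. odd_weight h m = 5 ^ i"
proof -
  obtain xs where xs: "length xs = odd_deg h m" "odd_weight h m = (\<Sum>x\<leftarrow>xs. 5 ^ (2 * x + 1))"
    using weighted_sum_as_list[OF odd_deg_def[symmetric, of m h]] unfolding odd_weight_def by metis
  show "odd_deg h m = 0 \<Longrightarrow> odd_weight h m = 0"
    using xs by simp
  assume "odd_deg h m = 1"
  with xs obtain x where "odd_weight h m = 5 ^ (2 * x + 1)"
    by (auto simp: length_Suc_conv)
  then show "\<exists>i. odd_weight h m = 5 ^ i" by blast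
qed

lemma deg_zero:
  assumes "m \<in> expvecs (2 * h)" "even_deg h m = 0" "odd_deg h m = 0"
  shows "m = 0"
proof (rule poly_mapping_eqI)
  fix j
  show "Poly_Mapping.lookup m j = Poly_Mapping.lookup 0 j"
  proof (cases "j \<in> {1..2 * h}")
    case True
    define i where "i = (j - 1) div 2"
    have "i < h" and j: "j = 2 * i + 1 \<or> j = 2 * i + 2"
      using True unfolding i_def by auto
    with assms(2,3) show ?thesis
      by (auto simp: even_deg_def odd_deg_def)
  next
    case False
    then show ?thesis using assms(1) by (auto simp: expvecs_def in_keys_iff)
  qed
qed

section \<open>Upper bounds for the number of summands\<close>

lemma zero_weight_cong:
  assumes "m \<in> zero_weight 5 (2 * h) 33"
  shows "(even_deg h m + 2 * odd_deg h m) mod 3 = 0" "11 dvd even_weight h m + odd_weight h m"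
proof -
  have w: "33 dvd even_weight h m + odd_weight h m"
    using assms by (simp add: zero_weight_def weight_eq)
  from dvd_trans[OF _ w, of 11] show "11 dvd even_weight h m + odd_weight h m" by simp
  from dvd_trans[OF _ w, of 3] have "(even_weight h m + odd_weight h m) mod 3 = 0" by simp
  then show "(even_deg h m + 2 * odd_deg h m) mod 3 = 0"
    using cong_add[OF even_weight_cong[of h m] odd_weight_cong[of h m]] by (simp add: cong_def)
qed

text \<open>Modulo 3, a nonzero vector of degree at most 2 must have degree 1 on each class. Its
  weight is then a sum of two powers of 5, which 11 does not divide.\<close>

lemma zero_weight_deg_ge_3:
  assumes "m \<in> zero_weight 5 (2 * h) 33 - {0}"
  shows "3 \<le> even_deg h m + odd_deg h m"
proof (rule ccontr)
  assume "\<not> ?thesis"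
  moreover have "even_deg h m \<noteq> 0 \<or> odd_deg h m \<noteq> 0"
    using assms deg_zero by (auto simp: zero_weight_def)
  moreover have "(even_deg h m + 2 * odd_deg h m) mod 3 = 0"
    using assms by (intro zero_weight_cong) simp
  ultimately have "even_deg h m = 1 \<and> odd_deg h m = 1" by presburger
  then obtain i j where "even_weight h m = 5 ^ i" "odd_weight h m = 5 ^ j"
    using even_weight_small odd_weight_small by blast
  with zero_weight_cong(2)[of m h] assms not_11_dvd_two_powers_5 show False by simp
qed

lemma factor_sums_deg:
  "m \<in> factor_sums 5 (2 * h) 33 l \<Longrightarrow> 3 * l \<le> even_deg h m + odd_deg h m"
proof (induction l arbitrary: m)
  case (Suc l)
  then obtain a b where ab: "m = a + b" "a \<in> factor_sums 5 (2 * h) 33 l"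
    "b \<in> zero_weight 5 (2 * h) 33 - {0}" by (auto simp: factor_sums.simps(2))
  from Suc.IH[OF ab(2)] zero_weight_deg_ge_3[OF ab(3)] show ?case
    by (simp add: ab(1) deg_weight_add)
qed simp

text \<open>
  Here \<open>a\<close> and \<open>b\<close> count the summands of degree 3, which live on one parity class by reduction
  modulo 3, and \<open>r\<close> is the sum of the \<open>c\<close> other ones.
\<close>

lemma factor_sums_decomp:
  "m \<in> factor_sums 5 (2 * h) 33 l \<Longrightarrow>
    \<exists>a b c r. l = a + b + c \<and> even_deg h m = 3 * a + even_deg h r
      \<and> odd_deg h m = 3 * b + odd_deg h r \<and> 4 * c \<le> even_deg h r + odd_deg h r
      \<and> even_weight h m mod 11 = even_weight h r mod 11"
proof (induction l arbitrary: m)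
  case 0
  show ?case by (intro exI[of _ "0::nat"] exI[of _ m]) simp
next
  case (Suc l)
  then obtain x y where xy: "m = x + y" "x \<in> factor_sums 5 (2 * h) 33 l"
    "y \<in> zero_weight 5 (2 * h) 33 - {0}" by (auto simp: factor_sums.simps(2))
  from Suc.IH[OF xy(2)] obtain a b c r where IH: "l = a + b + c"
    "even_deg h x = 3 * a + even_deg h r" "odd_deg h x = 3 * b + odd_deg h r"
    "4 * c \<le> even_deg h r + odd_deg h r" "even_weight h x mod 11 = even_weight h r mod 11"
    by blast
  have deg: "3 \<le> even_deg h y + odd_deg h y" by (rule zero_weight_deg_ge_3[OF xy(3)])
  have cong: "(even_deg h y + 2 * odd_deg h y) mod 3 = 0" "11 dvd even_weight h y + odd_weight h y"
    using zero_weight_cong[of y h] xy(3) by simp_all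
  \<comment> \<open>The mixed splittings 2 + 1 and 1 + 2 of degree 3 give the residues of 4 and 5
    modulo 3, which are nonzero.\<close>
  from deg cong(1) consider "even_deg h y = 3" "odd_deg h y = 0" | "even_deg h y = 0" "odd_deg h y = 3"
    | "4 \<le> even_deg h y + odd_deg h y"
  proof -
    have "even_deg h y = 3 \<and> odd_deg h y = 0 \<or> even_deg h y = 0 \<and> odd_deg h y = 3
        \<or> 4 \<le> even_deg h y + odd_deg h y"
      using deg cong(1) by presburger
    then show ?thesis using that by blast
  qed
  then show ?case
  proof cases
    case 1
    \<comment> \<open>Without an odd part, 11 divides the even weight of \<open>y\<close> alone, so
      \<open>y\<close> does not change the residue.\<close>
    then have "even_weight h y mod 11 = 0"
      using cong(2) odd_weight_small(1) by simp
    then have "even_weight h m mod 11 = even_weight h r mod 11"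
      using IH(5) by (simp add: xy(1) deg_weight_add mod_add_eq[symmetric])
    with 1 IH show ?thesis
      by (intro exI[of _ "Suc a"] exI[of _ b] exI[of _ c] exI[of _ r]) (simp add: xy(1) deg_weight_add)
  next
    case 2
    then have "even_weight h m mod 11 = even_weight h r mod 11"
      using IH(5) even_weight_small(1) by (simp add: xy(1) deg_weight_add)
    with 2 IH show ?thesis
      by (intro exI[of _ a] exI[of _ "Suc b"] exI[of _ c] exI[of _ r]) (simp add: xy(1) deg_weight_add)
  next
    case 3
    have "even_weight h m mod 11 = even_weight h (r + y) mod 11"
      unfolding xy(1) deg_weight_add by (rule mod_add_cong[OF IH(5) refl])
    with 3 IH(1-4) show ?thesis
      by (intro exI[of _ a] exI[of _ b] exI[of _ "Suc c"] exI[of _ "r + y"] conjI)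
        (simp_all add: xy(1) deg_weight_add)
  qed
qed

lemma box_deg_le:
  assumes "m \<in> expvecs (2 * h)" "\<not> (\<exists>j\<in>{1..2 * h}. 5 \<le> Poly_Mapping.lookup m j)"
  shows "even_deg h m \<le> 4 * h" "odd_deg h m \<le> 4 * h"
proof -
  have le: "Poly_Mapping.lookup m j \<le> 4" if "j \<in> {1..2 * h}" for j
  proof -
    from assms(2) that have "\<not> 5 \<le> Poly_Mapping.lookup m j" by blast
    then show ?thesis by simp
  qed
  have "even_deg h m \<le> (\<Sum>i<h. 4)" "odd_deg h m \<le> (\<Sum>i<h. 4)"
    unfolding even_deg_def odd_deg_def by (intro sum_mono le; simp)+
  then show "even_deg h m \<le> 4 * h" "odd_deg h m \<le> 4 * h" by simp_all
qed

text \<open>Each entry is at most 4, so the maximal total degree forces every entry on the class to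
  equal 4.\<close>

lemma box_even_weight:
  assumes "\<not> (\<exists>j\<in>{1..2 * h}. 5 \<le> Poly_Mapping.lookup m j)" "even_deg h m = 4 * h"
  shows "even_weight h m = 4 * (\<Sum>i<h. 5 ^ (2 * i))"
proof -
  have le: "Poly_Mapping.lookup m (2 * i + 1) \<le> 4" if "i < h" for i
  proof -
    have "2 * i + 1 \<in> {1..2 * h}" using that by simp
    with assms(1) have "\<not> 5 \<le> Poly_Mapping.lookup m (2 * i + 1)" by blast
    then show ?thesis by simp
  qed
  have "Poly_Mapping.lookup m (2 * i + 1) = 4" if "i < h" for i
  proof (rule ccontr)
    assume "Poly_Mapping.lookup m (2 * i + 1) \<noteq> 4"
    with le[OF that] have "Poly_Mapping.lookup m (2 * i + 1) < 4" by simp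
    then have "even_deg h m < (\<Sum>i<h. 4)"
      unfolding even_deg_def using that le by (intro sum_strict_mono_ex1) auto
    with assms(2) show False by simp
  qed
  then show ?thesis by (simp add: even_weight_def sum_distrib_left mult.commute)
qed

text \<open>The order of 25 modulo 11 is 5, so five consecutive even powers of 5 sum to zero: 1 + 25
  + ... + 25^4 = 406901 = 11 * 36991.\<close>

lemma full_even_weight: "11 dvd (\<Sum>i<5 * k. 5 ^ (2 * i) :: nat)"
proof (induction k)
  case (Suc k)
  have "(\<Sum>i<5 * Suc k. 5 ^ (2 * i) :: nat) = (\<Sum>i<5 * k. 5 ^ (2 * i)) + 5 ^ (10 * k) * (11 * 36991)"
  proof -
    have "5 * Suc k = Suc (Suc (Suc (Suc (Suc (5 * k)))))" by simp
    then show ?thesis by (simp only: sum.lessThan_Suc) (simp add: power_mult[symmetric] mult.assoc)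
  qed
  with Suc show ?case by simp
qed simp

lemma factor_sums_expvecs: "m \<in> factor_sums q n e l \<Longrightarrow> m \<in> expvecs n"
  using factor_sums_subset[of q n e l] by (auto simp: zero_weight_def)

text \<open>The summands have total degree at least \<open>3 * l\<close>, whereas
  \<open>2 * h\<close> positions with entries at most 4 hold only \<open>8 * h\<close>.\<close>

lemma factor_sums_outside:
  assumes "8 * h < 3 * l"
  shows "factor_sums 5 (2 * h) 33 l
    \<subseteq> {m \<in> expvecs (2 * h). \<exists>j\<in>{1..2 * h}. 5 \<le> Poly_Mapping.lookup m j}"
proof
  fix m assume m: "m \<in> factor_sums 5 (2 * h) 33 l"
  then have e: "m \<in> expvecs (2 * h)" by (rule factor_sums_expvecs)
  moreover have "\<exists>j\<in>{1..2 * h}. 5 \<le> Poly_Mapping.lookup m j"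
    using factor_sums_deg[OF m] box_deg_le[OF e] assms by fastforce
  ultimately
  show "m \<in> {m \<in> expvecs (2 * h). \<exists>j\<in>{1..2 * h}. 5 \<le> Poly_Mapping.lookup m j}" by blast
qed

text \<open>Degrees alone do not suffice here: the summands need at least 3 (40k + 13) = 120k + 39
  out of a capacity of 120k + 40. Residues modulo 11 decide.\<close>

lemma factor_sums_outside_exceptional:
  assumes "h = 15 * k + 5"
  shows "factor_sums 5 (2 * h) 33 (40 * k + 13)
    \<subseteq> {m \<in> expvecs (2 * h). \<exists>j\<in>{1..2 * h}. 5 \<le> Poly_Mapping.lookup m j}"
proof
  fix m assume m: "m \<in> factor_sums 5 (2 * h) 33 (40 * k + 13)"
  then have e: "m \<in> expvecs (2 * h)" by (rule factor_sums_expvecs)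
  have "\<exists>j\<in>{1..2 * h}. 5 \<le> Poly_Mapping.lookup m j"
  proof (rule ccontr)
    assume box: "\<not> ?thesis"
    from factor_sums_decomp[OF m] obtain a b c r where r: "40 * k + 13 = a + b + c"
      "even_deg h m = 3 * a + even_deg h r" "odd_deg h m = 3 * b + odd_deg h r"
      "4 * c \<le> even_deg h r + odd_deg h r" "even_weight h m mod 11 = even_weight h r mod 11"
      by blast
    have le: "even_deg h m \<le> 60 * k + 20" "odd_deg h m \<le> 60 * k + 20"
      using box_deg_le[OF e box] assms by simp_all
    \<comment> \<open>From 3a and 3b being at most 60k + 20 follow the first two bounds, and 4c
      \<le> 3c + 1 from the total degree. Hence c = 1 and a = b = 20k + 6. At most 2 units remain on
      each class while \<open>r\<close> needs 4, so both classes are full.\<close>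
    with r have "a \<le> 20 * k + 6" "b \<le> 20 * k + 6" "c \<le> 1" by linarith+
    with r le have "even_deg h r = 2" "even_deg h m = 60 * k + 20" by linarith+
    \<comment> \<open>Here \<open>h\<close> is a multiple of 5, so the full class consists of whole
      periods of 25 modulo 11.\<close>
    then have "even_weight h m = 4 * (\<Sum>i<5 * (3 * k + 1). 5 ^ (2 * i))"
      using box_even_weight[OF box] assms by (simp add: algebra_simps)
    then have "11 dvd even_weight h m" using full_even_weight by (simp only: dvd_mult)
    then have "11 dvd even_weight h r" using r(5) by (simp add: dvd_eq_mod_eq_0)
    with even_weight_small(3)[OF \<open>even_deg h r = 2\<close>] not_11_dvd_two_powers_5 show False by auto
  qed
  with e show "m \<in> {m \<in> expvecs (2 * h). \<exists>j\<in>{1..2 * h}. 5 \<le> Poly_Mapping.lookup m j}" by simp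
qed

section \<open>Packings and lower bounds\<close>

text \<open>A list \<open>xs\<close> of positions stands for the exponent vector \<open>\<lambda>j. count_list xs j\<close>.\<close>

definition packing :: "nat \<Rightarrow> nat list list \<Rightarrow> bool" where
  "packing n xss \<longleftrightarrow>
     (\<forall>xs\<in>set xss. xs \<noteq> [] \<and> set xs \<subseteq> {1..n} \<and> 33 dvd (\<Sum>x\<leftarrow>xs. 5 ^ (x - 1) :: nat)) \<and>
     (\<forall>j\<in>{1..n}. count_list (concat xss) j \<le> 4)"

definition vec_of :: "nat list \<Rightarrow> (nat \<Rightarrow>\<^sub>0 nat)" where
  "vec_of xs = (\<Sum>x\<leftarrow>xs. Poly_Mapping.single x 1)"

lemma vec_of_append: "vec_of (xs @ ys) = vec_of xs + vec_of ys"
  by (simp add: vec_of_def)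

lemma lookup_vec_of: "Poly_Mapping.lookup (vec_of xs) j = count_list xs j"
  by (induction xs) (auto simp: vec_of_def lookup_add lookup_single)

lemma weight_vec_of: "set xs \<subseteq> {1..n} \<Longrightarrow> weight q n (vec_of xs) = (\<Sum>x\<leftarrow>xs. q ^ (x - 1))"
proof (induction xs)
  case (Cons x xs)
  have "weight q n (Poly_Mapping.single x 1) = (\<Sum>j=1..n. if j = x then q ^ (x - 1) else 0)"
    unfolding weight_def by (intro sum.cong) (auto simp: lookup_single)
  with Cons show ?case by (simp add: vec_of_def weight_add)
qed (simp add: vec_of_def)

lemma packing_factor_sums:
  "packing n xss \<Longrightarrow> vec_of (concat xss) \<in> factor_sums 5 n 33 (length xss)"
proof -
  have "\<forall>xs\<in>set xss. xs \<noteq> [] \<and> set xs \<subseteq> {1..n} \<and> 33 dvd (\<Sum>x\<leftarrow>xs. 5 ^ (x - 1) :: nat) \<Longrightarrow>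
    vec_of (concat xss) \<in> factor_sums 5 n 33 (length xss)"
  proof (induction xss)
    case Nil
    then show ?case by (simp add: vec_of_def zero_in_zero_weight)
  next
    case (Cons xs xss)
    have "Poly_Mapping.keys (vec_of xs) = set xs"
      by (auto simp: in_keys_iff lookup_vec_of count_list_0_iff)
    with Cons.prems have "vec_of xs \<in> zero_weight 5 n 33 - {0}"
      by (auto simp: zero_weight_def expvecs_def weight_vec_of)
    moreover have "vec_of (concat xss) \<in> factor_sums 5 n 33 (length xss)"
      using Cons by simp
    ultimately have "vec_of (concat xss) + vec_of xs \<in> factor_sums 5 n 33 (Suc (length xss))"
      unfolding factor_sums.simps(2) by blast
    then show ?case by (simp add: vec_of_append add.commute)
  qed
  then show "packing n xss \<Longrightarrow> ?thesis" by (simp add: packing_def)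
qed

lemma packing_not_outside:
  assumes "packing n xss"
  shows "\<not> factor_sums 5 n 33 (length xss)
    \<subseteq> {m \<in> expvecs n. \<exists>j\<in>{1..n}. 5 \<le> Poly_Mapping.lookup m j}"
proof -
  have "count_list (concat xss) j < 5" if "j \<in> {1..n}" for j
  proof -
    have "count_list (concat xss) j \<le> 4" using assms that unfolding packing_def by blast
    then show ?thesis by simp
  qed
  then show ?thesis
    using packing_factor_sums[OF assms] by (force simp: lookup_vec_of not_le)
qed

text \<open>The order of 5 modulo 33 is 10: 5^10 has residue 1, and the smaller exponents are
  checked one by one.\<close>

lemma dvd_power_minus_one: "33 dvd (5::nat) ^ n - 1 \<longleftrightarrow> 10 dvd n"
proof -
  have "(5::nat) ^ n = (5 ^ 10) ^ (n div 10) * 5 ^ (n mod 10)"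
    unfolding power_mult[symmetric] power_add[symmetric] mult_div_mod_eq ..
  then have "(5::nat) ^ n mod 33 = ((5 ^ 10 mod 33) ^ (n div 10) * 5 ^ (n mod 10)) mod 33"
    by (metis mod_mult_left_eq power_mod)
  then have m: "(5::nat) ^ n mod 33 = 5 ^ (n mod 10) mod 33" by simp
  have "33 dvd (5::nat) ^ n - 1 \<longleftrightarrow> (5::nat) ^ n mod 33 = 1 mod 33"
    by (rule mod_eq_dvd_iff_nat[symmetric]) simp
  also have "\<dots> \<longleftrightarrow> n mod 10 = 0"
  proof -
    have "n mod 10 \<in> {..<10}" by simp
    then have "n mod 10 \<in> {9, 8, 7, 6, 5, 4, 3, 2, 1, 0}" by (simp add: lessThan_nat_numeral)
    then show ?thesis unfolding m by (elim insertE; simp)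
  qed
  finally show ?thesis by (simp add: dvd_eq_mod_eq_0)
qed

text \<open>Shifting positions by \<open>n\<close> multiplies weights by \<open>5 ^ n\<close>, which
  preserves divisibility by 33, and the two packings then occupy disjoint positions.\<close>

lemma packing_append:
  assumes "packing n xss" "packing n' yss" "10 dvd n"
  shows "packing (n + n') (xss @ map (map ((+) n)) yss)"
proof -
  have shift: "33 dvd (\<Sum>y\<leftarrow>ys. 5 ^ (n + y - 1) :: nat)"
    if "33 dvd (\<Sum>y\<leftarrow>ys. 5 ^ (y - 1) :: nat)" "set ys \<subseteq> {1..n'}" for ys
  proof -
    have "(\<Sum>y\<leftarrow>ys. 5 ^ (n + y - 1) :: nat) = 5 ^ n * (\<Sum>y\<leftarrow>ys. 5 ^ (y - 1))"
      using that(2) by (induction ys) (auto simp: algebra_simps simp flip: power_add)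
    with that(1) show ?thesis by simp
  qed
  have sub: "set (concat xss) \<subseteq> {1..n}" "set (concat yss) \<subseteq> {1..n'}"
    using assms(1,2) by (simp_all add: packing_def UN_subset_iff)
  have "count_list (concat xss @ map ((+) n) (concat yss)) j \<le> 4" if "j \<in> {1..n + n'}" for j
  proof (cases "j \<le> n")
    case True
    have "j \<notin> set (map ((+) n) (concat yss))"
      using True sub(2) by fastforce
    then have "count_list (map ((+) n) (concat yss)) j = 0" using count_list_0_iff by metis
    moreover have "count_list (concat xss) j \<le> 4"
      using assms(1) True that unfolding packing_def by simp
    ultimately show ?thesis by simp
  next
    case False
    have "count_list (map ((+) n) ys) j = count_list ys (j - n)" for ys
      using False by (induction ys) auto
    moreover have "count_list (concat xss) j = 0"
      using False sub(1) by (auto simp: count_list_0_iff)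
    moreover have "j - n \<in> {1..n'}" using False that by auto
    then have "count_list (concat yss) (j - n) \<le> 4"
      using assms(2) unfolding packing_def by blast
    ultimately show ?thesis by simp
  qed
  moreover have "concat (xss @ map (map ((+) n)) yss) = concat xss @ map ((+) n) (concat yss)"
    by (simp add: map_concat)
  moreover have "xs \<noteq> [] \<and> set xs \<subseteq> {1..n + n'} \<and> 33 dvd (\<Sum>x\<leftarrow>xs. 5 ^ (x - 1) :: nat)"
    if "xs \<in> set (xss @ map (map ((+) n)) yss)" for xs
    using that assms(1,2) shift by (fastforce simp: packing_def o_def)
  ultimately show ?thesis unfolding packing_def by metis
qed

lemma packing_0: "packing 0 []"
  by (simp add: packing_def)

text \<open>The packings for \<open>n = 10\<close> and \<open>n = 20\<close> were found by a computer search.\<close>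

lemma packing_10:
  "packing 10
    [[1,1,5], [1,1,5], [2,2,6], [2,8,8], [3,3,7], [3,9,9], [4,4,8], [4,10,10], [2,4,5,9],
      [3,5,6,10], [6,6,7,9], [7,7,8,10]]"
  unfolding packing_def atLeastAtMost_upt by simp

lemma packing_20:
  "packing 20
    [[1,1,5], [1,1,5], [7,7,11], [7,7,11], [2,2,6], [2,2,6], [8,8,12], [8,8,12],
      [12,18,18], [3,3,17], [3,3,17], [13,13,17], [9,9,13], [9,9,13], [4,4,18], [4,4,18],
      [10,10,14], [10,10,14], [5,5,19], [15,15,19], [15,15,19], [6,6,20], [16,16,20],
      [16,16,20], [11,11,12,14], [14,17,19,20]]"
  unfolding packing_def atLeastAtMost_upt by simp

text \<open>
  For \<open>n = 30\<close> the multiset \<open>{i, i, i + 4}\<close> of exponents is used four times for every residue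
  \<open>i\<close> modulo 10.
\<close>

definition blocks_30 :: "nat list list" where
  "blocks_30 = concat (map (\<lambda>i. let k = (i + 4) mod 10 + 21 in
     [[i + 1, i + 1, k], [i + 1, i + 1, k], [i + 11, i + 11, k], [i + 11, i + 11, k]]) [0, 1, 2, 3, 4, 5, 6, 7, 8, 9])"

text \<open>Since 5^10 is 1 modulo 33, each block has weight congruent to a multiple of 2 + 5^4 = 33
  * 19. Positions 1 to 20 occur doubled in two blocks each and positions 21 to 30 once in four, so
  40 vectors of degree 3 fill the capacity of 120.\<close>

lemma packing_30: "packing 30 blocks_30" "length blocks_30 = 40"
  unfolding packing_def atLeastAtMost_upt blocks_30_def Let_def by simp_all

lemma ex_packing_add_30:
  assumes "packing n xss" "10 dvd n"
  shows "\<exists>yss. packing (n + 30 * k) yss \<and> length yss = length xss + 40 * k"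
proof (induction k)
  case 0
  show ?case using assms(1) by auto
next
  case (Suc k)
  then obtain yss where "packing (n + 30 * k) yss" "length yss = length xss + 40 * k" by blast
  moreover have "10 dvd n + 30 * k" using assms(2) by simp
  moreover note packing_append[OF _ packing_30(1), of "n + 30 * k" yss]
  ultimately show ?case
    using packing_30(2)
    by (intro exI[of _ "yss @ map (map ((+) (n + 30 * k))) blocks_30"]) (simp add: algebra_simps)
qed

text \<open>A packing of \<open>r\<close> positions followed by \<open>k\<close> copies of the full
  packing of 30 positions gives the lower bound; the last assumption is the matching upper
  bound.\<close>

lemma loewy_length_5_33:
  assumes "n = r + 30 * k" "packing r xss" "10 dvd r" "l = length xss + 40 * k"
    and "factor_sums 5 n 33 (Suc l)
      \<subseteq> {m \<in> expvecs n. \<exists>j\<in>{1..n}. 5 \<le> Poly_Mapping.lookup m j}"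
  shows "loewy_length (A_alg F 5 n 33) = Suc l"
proof (rule loewy_length_A_alg)
  obtain yss where "packing n yss" "length yss = l"
    using ex_packing_add_30[OF assms(2,3), of k] assms(1,4) by auto
  then show "\<not> factor_sums 5 n 33 l
      \<subseteq> {m \<in> expvecs n. \<exists>j\<in>{1..n}. 5 \<le> Poly_Mapping.lookup m j}"
    using packing_not_outside by blast
qed (use assms(5) in simp_all)

theorem proposition6p2:
  fixes q e m :: nat
  assumes "q = 5" and "e = 33" and "m = m_number q e"
  shows "m = 3 \<and>
    (\<forall>n::nat. n > 0 \<and> e dvd q ^ n - 1 \<longrightarrow>
      int (loewy_length (A_alg TYPE('f::field) q n e)) =
        \<lfloor>real ((q - 1) * n) / real m\<rfloor> + (if [n = 10] (mod 30) then 0 else 1))"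
proof (intro conjI allI impI)
  show m: "m = 3" using assms m_number_5_33 by simp
  fix n :: nat
  assume "n > 0 \<and> e dvd q ^ n - 1"
  then have "10 dvd n" using assms dvd_power_minus_one by simp
  define k where "k = n div 30"
  from \<open>10 dvd n\<close> have "n = 0 + 30 * k \<or> n = 10 + 30 * k \<or> n = 20 + 30 * k"
    unfolding k_def by presburger
  moreover have floor: "\<lfloor>real ((q - 1) * n) / real m\<rfloor> = int (4 * n div 3)"
    using assms(1) m floor_divide_of_nat_eq[of "4 * n" 3] by simp
  \<comment> \<open>For \<open>n\<close> equal to 30k, 30k + 10 and 30k + 20 the floor is 40k, 40k +
    13 and 40k + 26, while the largest packings have 40k, 40k + 12 and 40k + 26 members. The Loewy
    length is one more than the latter.\<close>
  moreover have "loewy_length (A_alg TYPE('f) 5 (0 + 30 * k) 33) = Suc (0 + 40 * k)"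
    using factor_sums_outside[of "15 * k" "Suc (40 * k)"]
    by (intro loewy_length_5_33[OF _ packing_0]) simp_all
  moreover have "loewy_length (A_alg TYPE('f) 5 (10 + 30 * k) 33) = Suc (12 + 40 * k)"
    using factor_sums_outside_exceptional[of "15 * k + 5" k]
    by (intro loewy_length_5_33[OF _ packing_10]) (simp_all add: add.commute)
  moreover have "loewy_length (A_alg TYPE('f) 5 (20 + 30 * k) 33) = Suc (26 + 40 * k)"
    using factor_sums_outside[of "15 * k + 10" "Suc (26 + 40 * k)"]
    by (intro loewy_length_5_33[OF _ packing_20]) (simp_all add: add.commute)
  ultimately show "int (loewy_length (A_alg TYPE('f) q n e)) =
        \<lfloor>real ((q - 1) * n) / real m\<rfloor> + (if [n = 10] (mod 30) then 0 else 1)"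
    using assms(1,2) by (elim disjE) (simp_all add: cong_def floor del: of_nat_mult of_nat_numeral)
qed

end
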